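(* Consider the sequential localization game described in the context, for a scalar random variable state $x_0$, with action-observation noise variance $\sigma_\epsilon^2>0$. Let $\Sigma_k$ denote the covariance of our estimate of $x_0$ at time $k$. Then for large $k$, $\Sigma_k = 2k^{-1}$, in the sense that $\lim_{k\to\infty} k\,\Sigma_k = 2$ (twice the covariance $k^{-1}$ of classical localization with one unit-variance noise observation of $x_0$ per time step). The same result holds for the covariance of the adversary's estimate of $x_0$.
   Context: Two players, "us" and "the adversary", both localize an unknown scalar $x_0\in\mathbb R$ with non-informative Gaussian prior (prior covariance $\Sigma_0=\infty$, i.e. prior precision $\Sigma_0^{-1}=0$). Active measurements of $x_0$ have the form $y_k=x_0+v_k$, with $v_k\sim N(0,1)$ i.i.d. Each player's action is its current conditional-mean estimate, $u_k=\hat x_k$, and the other player observes it in noise as $a_k=u_k+\epsilon_k$, with $\epsilon_k\sim N(0,\sigma_\epsilon^2)$ i.i.d.; all noises are mutually independent. Odd times $k=1,3,\dots$: the adversary has the noisy measurement $a_{k-1}=u_{k-1}+\epsilon_{k-1}$ of our action $u_{k-1}=\hat x_{k-1}$ (our estimate, with covariance $\Sigma_{k-1}$). It treats $a_{k-1}$ as our state estimate, takes an active measurement $y_k$, and forms by the Kalman filter the estimate $(1-\psi_k)a_{k-1}+\psi_k y_k$, with gain $\psi_k=(1+\Sigma_{k-1}^{-1})^{-1}$, which is its action. We observe this action as $a_k=(1-\psi_k)a_{k-1}+\psi_k y_k+\epsilon_k$. Since we know $u_{k-1}$, our effective observation of $x_0$ is $$z_k=\frac{a_k}{\psi_k}-\frac{1-\psi_k}{\psi_k}u_{k-1}=x_0+\frac{1-\psi_k}{\psi_k}\epsilon_{k-1}+v_k+\frac{\epsilon_k}{\psi_k},$$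 whose noise has variance $\bar R_k=\frac{(1-\psi_k)^2}{\psi_k^2}\sigma_\epsilon^2+\frac{\sigma_\epsilon^2}{\psi_k^2}+1$. We update our estimate with $z_k$ by the Kalman filter, so $\Sigma_k^{-1}=\Sigma_{k-1}^{-1}+\bar R_k^{-1}$. Even times $k=2,4,\dots$: we take an active measurement $y_k$ of $x_0$ and update our estimate by the Kalman filter, so $\Sigma_k^{-1}=\Sigma_{k-1}^{-1}+1$; we then take action $u_k=\hat x_k$, which the adversary observes in noise and uses to localize $x_0$. The adversary's estimate is governed by the same equations with the roles of the two players, hence of odd and even times, exchanged: writing $\Sigma'_k$ for its covariance ($\Sigma_0'^{-1}=0$), at odd $k$ one has $\Sigma_k'^{-1}=\Sigma_{k-1}'^{-1}+1$, and at even $k$ one has $\Sigma_k'^{-1}=\Sigma_{k-1}'^{-1}+\bar R_k'^{-1}$, with $\bar R'_k$ given by the formula for $\bar R_k$ with $\psi_k$ replaced by $\psi'_k=(1+\Sigma_{k-1}'^{-1})^{-1}$. *)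

theory Defs
  imports "HOL-Probability.Probability"
begin

section \<open>Scalar Kalman measurement update\<close>

text \<open>
  The filter is kept in terms of the precision \<open>P = 1/\<Sigma>\<close>, so that the non-informative prior
  \<open>\<Sigma> = \<infinity>\<close> is simply \<open>P = 0\<close>. With prior mean \<open>m\<close> and an observation \<open>z\<close> of the state in noise
  of variance \<open>R\<close>, the usual gain \<open>\<Sigma> / (\<Sigma> + R)\<close> is \<open>(1/R) / (P + 1/R)\<close>, which equals 1 for \<open>P = 0\<close>.
\<close>

definition kalman_prec :: "real \<Rightarrow> real \<Rightarrow> real" where
  "kalman_prec P R = P + 1 / R"

definition kalman_mean :: "real \<Rightarrow> real \<Rightarrow> real \<Rightarrow> real \<Rightarrow> real" where
  "kalman_mean P R m z = m + (1 / R) / kalman_prec P R * (z - m)"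

section \<open>The localization game\<close>

datatype player = Us | Adversary

fun measures_at :: "player \<Rightarrow> nat \<Rightarrow> bool" where
  "measures_at Us k \<longleftrightarrow> even k"
| "measures_at Adversary k \<longleftrightarrow> odd k"

text \<open>\<open>psi P\<close> is the Kalman gain of the opponent, who takes the observed action for an estimate of
  precision \<open>P\<close> and measures the state in unit-variance noise.\<close>

definition psi :: "real \<Rightarrow> real" where
  "psi P = 1 / (1 + P)"

text \<open>Variance of the noise in \<open>effective_obs\<close> below; \<open>\<sigma>\<close> is the standard deviation of the
  action-observation noise.\<close>

definition Rbar :: "real \<Rightarrow> real \<Rightarrow> real" where
  "Rbar \<sigma> P = (1 - psi P)\<^sup>2 / (psi P)\<^sup>2 * \<sigma>\<^sup>2 + \<sigma>\<^sup>2 / (psi P)\<^sup>2 + 1"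

primrec precision :: "player \<Rightarrow> real \<Rightarrow> nat \<Rightarrow> real" where
  "precision p \<sigma> 0 = 0"
| "precision p \<sigma> (Suc k) =
     kalman_prec (precision p \<sigma> k)
       (if measures_at p (Suc k) then 1 else Rbar \<sigma> (precision p \<sigma> k))"

text \<open>At \<open>k = 0\<close> the covariance is infinite; there the definition below returns the junk value 0.
  All precisions at \<open>k \<ge> 1\<close> are positive.\<close>

definition covariance :: "player \<Rightarrow> real \<Rightarrow> nat \<Rightarrow> real" where
  "covariance p \<sigma> k = 1 / precision p \<sigma> k"

text \<open>The following describes one realization, with true state \<open>x\<close>, measurement noises \<open>v\<close> and
  action-observation noises \<open>\<epsilon>\<close>. In \<open>observed_action\<close>, \<open>u\<close> is the player's action at time \<open>k - 1\<close>,
  which the opponent sees as \<open>u + \<epsilon> (k - 1)\<close>; the result is what the player sees of the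
  opponent's action at time \<open>k\<close>.\<close>

definition measurement :: "real \<Rightarrow> (nat \<Rightarrow> real) \<Rightarrow> nat \<Rightarrow> real" where
  "measurement x v k = x + v k"

definition observed_action ::
  "real \<Rightarrow> (nat \<Rightarrow> real) \<Rightarrow> (nat \<Rightarrow> real) \<Rightarrow> real \<Rightarrow> real \<Rightarrow> nat \<Rightarrow> real" where
  "observed_action x v \<epsilon> P u k =
     (1 - psi P) * (u + \<epsilon> (k - 1)) + psi P * measurement x v k + \<epsilon> k"

definition effective_obs ::
  "real \<Rightarrow> (nat \<Rightarrow> real) \<Rightarrow> (nat \<Rightarrow> real) \<Rightarrow> real \<Rightarrow> real \<Rightarrow> nat \<Rightarrow> real" where
  "effective_obs x v \<epsilon> P u k =
     observed_action x v \<epsilon> P u k / psi P - (1 - psi P) / psi P * u"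

text \<open>The value 0 of the initial estimate is immaterial: since the prior precision is 0, the gain of
  the first update is 1, and the action at time 0 enters with weight \<open>1 - psi 0 = 0\<close>.
  The two players' estimates are each computed on the premise that the opponent forms its action
  by \<open>observed_action\<close>; they refer to the same state and noises.\<close>

primrec estimate ::
  "player \<Rightarrow> real \<Rightarrow> real \<Rightarrow> (nat \<Rightarrow> real) \<Rightarrow> (nat \<Rightarrow> real) \<Rightarrow> nat \<Rightarrow> real" where
  "estimate p \<sigma> x v \<epsilon> 0 = 0"
| "estimate p \<sigma> x v \<epsilon> (Suc k) =
     (let P = precision p \<sigma> k; u = estimate p \<sigma> x v \<epsilon> k in
      if measures_at p (Suc k)
      then kalman_mean P 1 u (measurement x v (Suc k))
      else kalman_mean P (Rbar \<sigma> P) u (effective_obs x v \<epsilon> P u (Suc k)))"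

section \<open>Probabilistic model\<close>

datatype source = State | Measurement_Noise nat | Action_Noise nat

fun source_var ::
  "('w \<Rightarrow> real) \<Rightarrow> (nat \<Rightarrow> 'w \<Rightarrow> real) \<Rightarrow> (nat \<Rightarrow> 'w \<Rightarrow> real) \<Rightarrow> source \<Rightarrow> 'w \<Rightarrow> real" where
  "source_var x\<^sub>0 v \<epsilon> State = x\<^sub>0"
| "source_var x\<^sub>0 v \<epsilon> (Measurement_Noise k) = v k"
| "source_var x\<^sub>0 v \<epsilon> (Action_Noise k) = \<epsilon> k"

text \<open>The law of \<open>x\<^sub>0\<close> is arbitrary (a point mass, for instance): a flat prior is not a
  probability law, so it enters only through the players' filters, which start at precision 0.\<close>

definition localization_game ::
  "'w measure \<Rightarrow> real \<Rightarrow> ('w \<Rightarrow> real) \<Rightarrow> (nat \<Rightarrow> 'w \<Rightarrow> real) \<Rightarrow> (nat \<Rightarrow> 'w \<Rightarrow> real) \<Rightarrow> bool" where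
  "localization_game M \<sigma> x\<^sub>0 v \<epsilon> \<longleftrightarrow>
     prob_space M \<and>
     prob_space.indep_vars M (\<lambda>_. borel) (source_var x\<^sub>0 v \<epsilon>) UNIV \<and>
     (\<forall>k. distributed M lborel (v k) (normal_density 0 1)) \<and>
     (\<forall>k. distributed M lborel (\<epsilon> k) (normal_density 0 \<sigma>))"

definition mean_square_error ::
  "'w measure \<Rightarrow> player \<Rightarrow> real \<Rightarrow> ('w \<Rightarrow> real) \<Rightarrow> (nat \<Rightarrow> 'w \<Rightarrow> real) \<Rightarrow> (nat \<Rightarrow> 'w \<Rightarrow> real) \<Rightarrow> nat \<Rightarrow> real"
where
  "mean_square_error M p \<sigma> x\<^sub>0 v \<epsilon> k =
     (\<integral>\<omega>. (estimate p \<sigma> (x\<^sub>0 \<omega>) (\<lambda>j. v j \<omega>) (\<lambda>j. \<epsilon> j \<omega>) k - x\<^sub>0 \<omega>)\<^sup>2 \<partial>M)"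

end

theory Submission
  imports Defs
begin

text \<open>
  In information form the filter is additive: if \<open>e\<^sub>k\<close> is the estimation error and \<open>P\<^sub>k\<close> the precision,
  then \<open>P\<^sub>k\<^sub>+\<^sub>1 e\<^sub>k\<^sub>+\<^sub>1 = P\<^sub>k e\<^sub>k + n / R\<close>, where \<open>n\<close> is the noise of the new observation and \<open>R\<close> its
  variance. The noise terms entering at different times are disjoint, so \<open>P\<^sub>k e\<^sub>k\<close> has variance \<open>P\<^sub>k\<close>,
  and \<open>e\<^sub>k\<close> has variance \<open>1 / P\<^sub>k\<close>.

  Half of the steps increase the precision by 1, hence \<open>P\<^sub>k \<ge> (k - 1) / 2\<close>. The other half increase it by
  \<open>1 / Rbar\<close>, which is at most \<open>1 / (\<sigma>\<^sup>2 (1 + P\<^sub>k)\<^sup>2)\<close> and therefore summable. So \<open>P\<^sub>k - k / 2\<close> is bounded.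
\<close>

section \<open>Linear combinations of independent noises\<close>

text \<open>\<open>S\<close> only bounds the indices that occur, so it can be enlarged freely.
  \<open>V\<close> is the variance of the sum when the \<open>X i\<close> are independent with
  standard deviations \<open>sd i\<close>. The definition is purely algebraic; probability enters
  only when the second moment is taken.\<close>

definition noise_combination ::
  "('i \<Rightarrow> 'w \<Rightarrow> real) \<Rightarrow> ('i \<Rightarrow> real) \<Rightarrow> 'i set \<Rightarrow> real \<Rightarrow> ('w \<Rightarrow> real) \<Rightarrow> bool" where
  "noise_combination X sd S V Y \<longleftrightarrow>
     (\<exists>A c. finite A \<and> A \<subseteq> S \<and> (\<forall>\<omega>. Y \<omega> = (\<Sum>i\<in>A. c i * X i \<omega>)) \<and> V = (\<Sum>i\<in>A. (c i * sd i)\<^sup>2))"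

lemma noise_combination_zero: "noise_combination X sd S 0 (\<lambda>_. 0)"
  unfolding noise_combination_def by (intro exI[of _ "{}"]) auto

lemma noise_combination_single:
  "i \<in> S \<Longrightarrow> noise_combination X sd S ((a * sd i)\<^sup>2) (\<lambda>\<omega>. a * X i \<omega>)"
  unfolding noise_combination_def by (intro exI[of _ "{i}"] exI[of _ "\<lambda>_. a"]) auto

text \<open>Disjoint supports share no noise, so the coefficients can be glued together and the
  variances add without cross terms.\<close>

lemma noise_combination_add:
  assumes "noise_combination X sd S V Y" "noise_combination X sd T W Z" "S \<inter> T = {}"
    "S \<union> T \<subseteq> U"
  shows "noise_combination X sd U (V + W) (\<lambda>\<omega>. Y \<omega> + Z \<omega>)"
proof -
  obtain A c where A: "finite A" "A \<subseteq> S" "\<And>\<omega>. Y \<omega> = (\<Sum>i\<in>A. c i * X i \<omega>)"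
      "V = (\<Sum>i\<in>A. (c i * sd i)\<^sup>2)"
    using assms(1) by (auto simp: noise_combination_def)
  obtain B d where B: "finite B" "B \<subseteq> T" "\<And>\<omega>. Z \<omega> = (\<Sum>i\<in>B. d i * X i \<omega>)"
      "W = (\<Sum>i\<in>B. (d i * sd i)\<^sup>2)"
    using assms(2) by (auto simp: noise_combination_def)
  define e where "e i = (if i \<in> A then c i else d i)" for i
  have AB: "A \<inter> B = {}"
    using A(2) B(2) assms(3) by auto
  have eB: "e i = d i" if "i \<in> B" for i
    using that AB by (auto simp: e_def)
  have eA: "e i = c i" if "i \<in> A" for i
    using that by (simp add: e_def)
  have "Y \<omega> + Z \<omega> = (\<Sum>i\<in>A \<union> B. e i * X i \<omega>)" for \<omega>
    unfolding sum.union_disjoint[OF A(1) B(1) AB] A(3) B(3)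
    by (intro arg_cong2[where f = "(+)"] sum.cong) (auto simp: eA eB)
  moreover have "V + W = (\<Sum>i\<in>A \<union> B. (e i * sd i)\<^sup>2)"
    unfolding sum.union_disjoint[OF A(1) B(1) AB] A(4) B(4)
    by (intro arg_cong2[where f = "(+)"] sum.cong) (auto simp: eA eB)
  ultimately show ?thesis
    unfolding noise_combination_def using A(1,2) B(1,2) assms(4)
    by (intro exI[of _ "A \<union> B"] exI[of _ e]) auto
qed

text \<open>A nonempty sum of independent centred normal variables is again centred normal, with the
  variances added; its second moment is then its variance.\<close>

lemma (in prob_space) noise_combination_second_moment:
  assumes comb: "noise_combination X sd S V Y"
    and indep: "indep_vars (\<lambda>_. borel) X S"
    and normal: "\<And>i. i \<in> S \<Longrightarrow> distributed M lborel (X i) (normal_density 0 (sd i))"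
    and pos: "\<And>i. i \<in> S \<Longrightarrow> 0 < sd i"
  shows "expectation (\<lambda>\<omega>. (Y \<omega>)\<^sup>2) = V"
proof -
  obtain A c where A: "finite A" "A \<subseteq> S" "\<And>\<omega>. Y \<omega> = (\<Sum>i\<in>A. c i * X i \<omega>)"
      "V = (\<Sum>i\<in>A. (c i * sd i)\<^sup>2)"
    using comb by (auto simp: noise_combination_def)
  \<comment> \<open>A term with zero coefficient has no density.\<close>
  define B where "B = {i\<in>A. c i \<noteq> 0}"
  have B: "finite B" "B \<subseteq> S" "\<And>i. i \<in> B \<Longrightarrow> c i \<noteq> 0"
    using A by (auto simp: B_def)
  have Y: "Y = (\<lambda>\<omega>. \<Sum>i\<in>B. c i * X i \<omega>)"
    unfolding A(3)[abs_def] B_def using A(1) by (intro ext sum.mono_neutral_right) auto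
  have V: "V = (\<Sum>i\<in>B. (c i * sd i)\<^sup>2)"
    unfolding A(4) B_def using A(1) by (intro sum.mono_neutral_right) auto
  show ?thesis
  proof (cases "B = {}")
    \<comment> \<open>The empty sum is the constant 0, which has no density, so it cannot go through
      the normal law.\<close>
    case True
    then show ?thesis by (simp add: Y V)
  next
    case False
    have "indep_vars (\<lambda>_. borel) (\<lambda>i \<omega>. c i * X i \<omega>) B"
      by (rule indep_vars_compose2[OF indep_vars_subset[OF indep B(2)]]) auto
    moreover have "distributed M lborel (\<lambda>\<omega>. c i * X i \<omega>) (normal_density 0 (\<bar>c i\<bar> * sd i))"
      if "i \<in> B" for i
      using normal_density_affine[of "X i" 0 "sd i" "c i" 0] normal pos B(3) that B(2) by auto
    ultimately have D: "distributed M lborel Y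
        (normal_density (\<Sum>i\<in>B. 0) (sqrt (\<Sum>i\<in>B. (\<bar>c i\<bar> * sd i)\<^sup>2)))"
      unfolding Y using False B pos by (intro sum_indep_normal) (auto simp: subset_iff)
    have V': "(\<Sum>i\<in>B. (\<bar>c i\<bar> * sd i)\<^sup>2) = V"
      by (simp add: V power_mult_distrib)
    have "V > 0"
      unfolding V using False B pos by (intro sum_pos) (fastforce simp: subset_iff)+
    moreover have D': "distributed M lborel Y (normal_density 0 (sqrt V))"
      using D V' by simp
    ultimately show ?thesis
      using normal_distributed_variance[OF _ D'] normal_distributed_expectation[OF _ D'] by simp
  qed
qed

section \<open>Precision\<close>

text \<open>\<open>1 / psi P = 1 + P\<close> and hence \<open>(1 - psi P) / psi P = P\<close>. The
  summands are the variances of the three noises in \<open>effective_obs_error\<close>.\<close>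

lemma Rbar_eq:
  assumes "P \<ge> 0"
  shows "Rbar \<sigma> P = (P * \<sigma>)\<^sup>2 + ((1 + P) * \<sigma>)\<^sup>2 + 1"
proof -
  have "(1 - psi P) / psi P = P" "1 / psi P = 1 + P"
    using assms by (auto simp: psi_def field_simps)
  then show ?thesis
    unfolding Rbar_def by (metis power_divide power_mult_distrib power_one mult_1 times_divide_eq_left)
qed

lemma Rbar_pos: "P \<ge> 0 \<Longrightarrow> Rbar \<sigma> P > 0"
  by (simp add: Rbar_eq add_nonneg_pos)

lemma measures_at_Suc [simp]: "measures_at p (Suc k) \<longleftrightarrow> \<not> measures_at p k"
  by (cases p) auto

lemma precision_nonneg: "precision p \<sigma> k \<ge> 0"
  by (induction k) (auto simp: kalman_prec_def intro!: add_nonneg_nonneg less_imp_le[OF Rbar_pos])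

lemma precision_pos:
  assumes "k \<ge> 1"
  shows "precision p \<sigma> k > 0"
proof -
  obtain j where "k = Suc j"
    using assms by (cases k) auto
  then show ?thesis
    using precision_nonneg[of p \<sigma> j] Rbar_pos[of "precision p \<sigma> j" \<sigma>]
    by (auto simp: kalman_prec_def intro!: add_nonneg_pos)
qed

section \<open>Mean square error\<close>

text \<open>An upper bound for the noises in the estimate at time \<open>k\<close>. If the player
  measures at time \<open>k\<close>, \<open>Action_Noise k\<close> is still fresh: it enters at time
  \<open>k + 1\<close>, through the opponent's view of the player's action.\<close>

definition spent_noises :: "player \<Rightarrow> nat \<Rightarrow> source set" where
  "spent_noises p k = Measurement_Noise ` {..k} \<union>
     Action_Noise ` {j. j < k \<or> j = k \<and> \<not> measures_at p k}"

text \<open>The 0 at \<open>State\<close> is a default value: the law of the state is arbitrary, and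
  \<open>spent_noises\<close> contains noises only.\<close>

fun noise_sd :: "real \<Rightarrow> source \<Rightarrow> real" where
  "noise_sd \<sigma> State = 0"
| "noise_sd \<sigma> (Measurement_Noise k) = 1"
| "noise_sd \<sigma> (Action_Noise k) = \<sigma>"

text \<open>Multiplying by the new precision turns the gain into \<open>1 / R\<close>. Splitting
  \<open>z - m\<close> as \<open>(z - x) - (m - x)\<close> then cancels the \<open>1 / R\<close>
  part of the new precision against the old error.\<close>

lemma kalman_mean_error:
  assumes "P + 1 / R \<noteq> 0"
  shows "kalman_prec P R * (kalman_mean P R m z - x) = P * (m - x) + (z - x) / R"
proof -
  have "kalman_prec P R * ((1 / R) / kalman_prec P R * (z - m)) = (z - m) / R"
    using assms by (simp add: kalman_prec_def)
  then have "kalman_prec P R * (kalman_mean P R m z - x) = kalman_prec P R * (m - x) + (z - m) / R"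
    unfolding kalman_mean_def by (simp add: algebra_simps)
  also have "\<dots> = P * (m - x) + (z - x) / R"
    by (simp add: kalman_prec_def algebra_simps diff_divide_distrib)
  finally show ?thesis .
qed

lemma effective_obs_error:
  assumes "P \<ge> 0"
  shows "effective_obs x v \<epsilon> P u k - x = P * \<epsilon> (k - 1) + v k + (1 + P) * \<epsilon> k"
proof -
  define q where "q = psi P"
  have q: "q \<noteq> 0" "(1 + P) * q = 1"
    using assms by (auto simp: q_def psi_def)
  have "effective_obs x v \<epsilon> P u k - x = (1 - q) / q * \<epsilon> (k - 1) + v k + 1 / q * \<epsilon> k"
    using q(1) by (simp add: effective_obs_def observed_action_def measurement_def flip: q_def)
      (simp add: field_simps)
  moreover have "(1 - q) / q = P" "1 / q = 1 + P"
    using q by (auto simp: field_simps)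
  ultimately show ?thesis
    by simp
qed

text \<open>By induction: the noise of each new observation is disjoint from the spent ones, and
  after division by \<open>R\<close> its variance \<open>1 / R\<close> is exactly the increment of
  the precision.\<close>

lemma weighted_error_combination:
  "noise_combination (source_var x\<^sub>0 v \<epsilon>) (noise_sd \<sigma>) (spent_noises p k) (precision p \<sigma> k)
     (\<lambda>\<omega>. precision p \<sigma> k * (estimate p \<sigma> (x\<^sub>0 \<omega>) (\<lambda>j. v j \<omega>) (\<lambda>j. \<epsilon> j \<omega>) k - x\<^sub>0 \<omega>))"
proof (induction k)
  case 0
  \<comment> \<open>The flat prior has precision 0, which removes the initial error whatever the
    state is.\<close>
  show ?case by (simp add: noise_combination_zero)
next
  case (Suc k)
  let ?comb = "noise_combination (source_var x\<^sub>0 v \<epsilon>) (noise_sd \<sigma>)"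
  define P where "P = precision p \<sigma> k"
  define E where "E \<omega> = estimate p \<sigma> (x\<^sub>0 \<omega>) (\<lambda>j. v j \<omega>) (\<lambda>j. \<epsilon> j \<omega>) k" for \<omega>
  have P: "P \<ge> 0"
    by (simp add: P_def precision_nonneg)
  note IH = Suc.IH[folded P_def E_def]
  show ?case
  proof (cases "measures_at p (Suc k)")
    case True
    have "?comb {Measurement_Noise (Suc k)} 1 (\<lambda>\<omega>. v (Suc k) \<omega>)"
      using noise_combination_single[of "Measurement_Noise (Suc k)" "{Measurement_Noise (Suc k)}"
        "source_var x\<^sub>0 v \<epsilon>" "noise_sd \<sigma>" 1] by simp
    from IH this have "?comb (spent_noises p (Suc k)) (P + 1) (\<lambda>\<omega>. P * (E \<omega> - x\<^sub>0 \<omega>) + v (Suc k) \<omega>)"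
      by (rule noise_combination_add) (use True in \<open>auto simp: spent_noises_def\<close>)
    moreover have "kalman_prec P 1 * (kalman_mean P 1 (E \<omega>) (x\<^sub>0 \<omega> + v (Suc k) \<omega>) - x\<^sub>0 \<omega>)
        = P * (E \<omega> - x\<^sub>0 \<omega>) + v (Suc k) \<omega>" for \<omega>
      using P by (subst kalman_mean_error) auto
    ultimately show ?thesis
      using True by (simp add: measurement_def Let_def flip: P_def E_def) (simp add: kalman_prec_def)
  next
    case False
    define R where "R = Rbar \<sigma> P"
    have R: "R > 0"
      using P by (simp add: R_def Rbar_pos)
    have "?comb {Action_Noise k, Measurement_Noise (Suc k)}
        ((P / R * noise_sd \<sigma> (Action_Noise k))\<^sup>2 + (1 / R * noise_sd \<sigma> (Measurement_Noise (Suc k)))\<^sup>2)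
        (\<lambda>\<omega>. P / R * source_var x\<^sub>0 v \<epsilon> (Action_Noise k) \<omega>
           + 1 / R * source_var x\<^sub>0 v \<epsilon> (Measurement_Noise (Suc k)) \<omega>)"
      by (rule noise_combination_add[where S = "{Action_Noise k}" and T = "{Measurement_Noise (Suc k)}"];
          (rule noise_combination_single)?) auto
    from noise_combination_add[OF this noise_combination_single[of "Action_Noise (Suc k)"
          "{Action_Noise (Suc k)}" _ _ "(1 + P) / R"] _ subset_refl]
    have "?comb {Action_Noise k, Measurement_Noise (Suc k), Action_Noise (Suc k)}
        ((P / R * \<sigma>)\<^sup>2 + (1 / R)\<^sup>2 + ((1 + P) / R * \<sigma>)\<^sup>2)
        (\<lambda>\<omega>. P / R * \<epsilon> k \<omega> + 1 / R * v (Suc k) \<omega> + (1 + P) / R * \<epsilon> (Suc k) \<omega>)"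
      by (simp add: insert_commute)
    \<comment> \<open>The effective noise has variance \<open>R\<close>; the weight
      \<open>1 / R\<close> divides this by \<open>R\<close> squared.\<close>
    moreover have "(P / R * \<sigma>)\<^sup>2 + (1 / R)\<^sup>2 + ((1 + P) / R * \<sigma>)\<^sup>2 = R / R\<^sup>2"
      by (subst (4) R_def) (simp add: Rbar_eq[OF P] power_mult_distrib power_divide flip: add_divide_distrib)
    moreover have "R / R\<^sup>2 = 1 / R"
      using R by (simp add: power2_eq_square)
    ultimately have noise: "?comb {Action_Noise k, Measurement_Noise (Suc k), Action_Noise (Suc k)} (1 / R)
        (\<lambda>\<omega>. P / R * \<epsilon> k \<omega> + 1 / R * v (Suc k) \<omega> + (1 + P) / R * \<epsilon> (Suc k) \<omega>)"
      by simp
    \<comment> \<open>Roles alternate: observing at \<open>Suc k\<close> means having measured at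
      \<open>k\<close>, so \<open>Action_Noise k\<close> is not yet in
      \<open>spent_noises p k\<close>.\<close>
    from IH noise have "?comb (spent_noises p (Suc k)) (P + 1 / R) (\<lambda>\<omega>. P * (E \<omega> - x\<^sub>0 \<omega>)
        + (P / R * \<epsilon> k \<omega> + 1 / R * v (Suc k) \<omega> + (1 + P) / R * \<epsilon> (Suc k) \<omega>))"
      by (rule noise_combination_add) (use False in \<open>auto simp: spent_noises_def\<close>)
    moreover have "kalman_prec P R * (kalman_mean P R (E \<omega>)
          (effective_obs (x\<^sub>0 \<omega>) (\<lambda>j. v j \<omega>) (\<lambda>j. \<epsilon> j \<omega>) P (E \<omega>) (Suc k)) - x\<^sub>0 \<omega>)
        = P * (E \<omega> - x\<^sub>0 \<omega>)
          + (P / R * \<epsilon> k \<omega> + 1 / R * v (Suc k) \<omega> + (1 + P) / R * \<epsilon> (Suc k) \<omega>)" for \<omega>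
    proof -
      have "P + 1 / R > 0"
        using P R by (intro add_nonneg_pos) auto
      then show ?thesis
        by (subst kalman_mean_error) (auto simp: effective_obs_error[OF P] simp flip: add_divide_distrib)
    qed
    ultimately show ?thesis
      using False by (simp add: Let_def flip: P_def E_def R_def) (simp add: kalman_prec_def)
  qed
qed

text \<open>The precision-weighted error has second moment \<open>P\<close>; dividing by the square
  of \<open>P\<close>, which is positive from time 1 on, gives \<open>1 / P\<close>.\<close>

lemma mean_square_error_eq_covariance:
  assumes "\<sigma> > 0" "localization_game M \<sigma> x\<^sub>0 v \<epsilon>" "k \<ge> 1"
  shows "mean_square_error M p \<sigma> x\<^sub>0 v \<epsilon> k = covariance p \<sigma> k"
proof -
  interpret prob_space M
    using assms(2) by (simp add: localization_game_def)
  define P where "P = precision p \<sigma> k"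
  define e where "e \<omega> = estimate p \<sigma> (x\<^sub>0 \<omega>) (\<lambda>j. v j \<omega>) (\<lambda>j. \<epsilon> j \<omega>) k - x\<^sub>0 \<omega>" for \<omega>
  have P: "P > 0"
    using assms(3) by (simp add: P_def precision_pos)
  have "expectation (\<lambda>\<omega>. (P * e \<omega>)\<^sup>2) = P"
  proof (rule noise_combination_second_moment)
    show "noise_combination (source_var x\<^sub>0 v \<epsilon>) (noise_sd \<sigma>) (spent_noises p k) P (\<lambda>\<omega>. P * e \<omega>)"
      unfolding P_def e_def by (rule weighted_error_combination)
    show "indep_vars (\<lambda>_. borel) (source_var x\<^sub>0 v \<epsilon>) (spent_noises p k)"
      using assms(2) by (auto simp: localization_game_def intro: indep_vars_subset)
    show "distributed M lborel (source_var x\<^sub>0 v \<epsilon> i) (normal_density 0 (noise_sd \<sigma> i))"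
      if "i \<in> spent_noises p k" for i
      using that assms(2) by (auto simp: localization_game_def spent_noises_def)
    show "0 < noise_sd \<sigma> i" if "i \<in> spent_noises p k" for i
      using that assms(1) by (auto simp: spent_noises_def)
  qed
  then have "P\<^sup>2 * expectation (\<lambda>\<omega>. (e \<omega>)\<^sup>2) = P"
    by (simp add: power_mult_distrib)
  then have "expectation (\<lambda>\<omega>. (e \<omega>)\<^sup>2) = 1 / P"
    using P by (simp add: field_simps power2_eq_square)
  then show ?thesis
    by (simp add: mean_square_error_def covariance_def P_def e_def)
qed

section \<open>Growth of the precision\<close>

text \<open>The number of times in 1, ..., \<open>k\<close> at which the player measures.\<close>

fun measurement_count :: "player \<Rightarrow> nat \<Rightarrow> nat" where
  "measurement_count Us k = k div 2"
| "measurement_count Adversary k = Suc k div 2"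

lemma measurement_count_bounds:
  "\<bar>real (measurement_count p k) - real k / 2\<bar> \<le> 1 / 2"
  by (cases p; cases "even k") (auto elim!: evenE oddE simp: field_simps)

lemma precision_eq_sum:
  "precision p \<sigma> k = measurement_count p k
     + (\<Sum>i<k. if measures_at p (Suc i) then 0 else 1 / Rbar \<sigma> (precision p \<sigma> i))"
proof (induction k)
  case 0
  show ?case by (cases p) auto
next
  case (Suc k)
  have "real (measurement_count p (Suc k))
      = measurement_count p k + (if measures_at p (Suc k) then 1 else 0)"
    by (cases p; cases "even k") (auto elim!: evenE oddE)
  then show ?case
    using Suc.IH by (simp add: kalman_prec_def)
qed

lemma precision_deviation_bounded:
  assumes "\<sigma> > 0"
  obtains C where "\<And>k. \<bar>precision p \<sigma> k - real k / 2\<bar> \<le> C"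
proof -
  define P where "P = precision p \<sigma>"
  define r where "r i = (if measures_at p (Suc i) then 0 else 1 / Rbar \<sigma> (P i))" for i
  have P_eq: "P k = measurement_count p k + (\<Sum>i<k. r i)" for k
    unfolding P_def r_def by (rule precision_eq_sum)
  have P_nonneg: "P i \<ge> 0" for i
    by (simp add: P_def precision_nonneg)
  have r_nonneg: "r i \<ge> 0" for i
    using Rbar_pos[OF P_nonneg, of \<sigma> i] by (simp add: r_def)
  have P_ge: "P i \<ge> (real i - 1) / 2" for i
  proof -
    have "(\<Sum>i<i. r i) \<ge> 0"
      by (intro sum_nonneg r_nonneg)
    then show ?thesis
      using P_eq[of i] measurement_count_bounds[of p i] by (simp add: abs_le_iff field_simps)
  qed
  \<comment> \<open>The 4 comes from squaring the bound
    \<open>1 + P i \<ge> (real i + 1) / 2\<close>.\<close>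
  define b where "b i = 4 / \<sigma>\<^sup>2 * (1 / (real i + 1)\<^sup>2)" for i
  have r_le: "r i \<le> b i" for i
  proof -
    have "(real i + 1) / 2 \<le> 1 + P i"
      using P_ge[of i] by simp
    then have "((real i + 1) / 2 * \<sigma>)\<^sup>2 \<le> ((1 + P i) * \<sigma>)\<^sup>2"
      using assms by (intro power_mono mult_right_mono) auto
    \<comment> \<open>Only the middle summand of \<open>Rbar_eq\<close> is kept.\<close>
    also have "\<dots> \<le> Rbar \<sigma> (P i)"
      by (simp add: Rbar_eq[OF P_nonneg])
    finally have "1 / Rbar \<sigma> (P i) \<le> 1 / ((real i + 1) / 2 * \<sigma>)\<^sup>2"
      using assms by (intro divide_left_mono mult_pos_pos Rbar_pos[OF P_nonneg]) auto
    also have "\<dots> = b i"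
      by (simp add: b_def power_mult_distrib power_divide)
    finally show ?thesis
      by (auto simp: r_def b_def)
  qed
  have "summable b"
    unfolding b_def using sums_summable[OF inverse_squares_sums]
    by (intro summable_mult) (simp add: add.commute)
  then have sum_r: "summable r"
    using r_nonneg r_le by (intro summable_comparison_test'[of b 0 r]) auto
  show thesis
  proof (rule that)
    fix k
    have "0 \<le> (\<Sum>i<k. r i)" "(\<Sum>i<k. r i) \<le> suminf r"
      using r_nonneg by (auto intro!: sum_nonneg sum_le_suminf[OF sum_r])
    \<comment> \<open>The 1/2 is the parity error of the measurement count; \<open>suminf r\<close>
      bounds all that is learned from the opponent's actions.\<close>
    then show "\<bar>precision p \<sigma> k - real k / 2\<bar> \<le> 1 / 2 + suminf r"
      using P_eq[of k] measurement_count_bounds[of p k] unfolding P_def by linarith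
  qed
qed

lemma covariance_asymptotics:
  assumes "\<sigma> > 0"
  shows "(\<lambda>k. real k * covariance p \<sigma> k) \<longlonglongrightarrow> 2"
proof -
  obtain C where C: "\<And>k. \<bar>precision p \<sigma> k - real k / 2\<bar> \<le> C"
    using precision_deviation_bounded[OF assms] by blast
  have "(\<lambda>k. (precision p \<sigma> k - real k / 2) / real k) \<longlonglongrightarrow> 0"
  proof (rule Lim_null_comparison)
    \<comment> \<open>At \<open>k = 0\<close> both sides are 0 by division by zero, so the bound
      holds for every \<open>k\<close>.\<close>
    show "\<forall>\<^sub>F k in sequentially. norm ((precision p \<sigma> k - real k / 2) / real k) \<le> C / real k"
      using C by (intro always_eventually) (auto intro!: divide_right_mono)
    show "(\<lambda>k. C / real k) \<longlonglongrightarrow> 0"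
      by (rule lim_const_over_n)
  qed
  then have "(\<lambda>k. (precision p \<sigma> k - real k / 2) / real k + 1 / 2) \<longlonglongrightarrow> 0 + 1 / 2"
    by (intro tendsto_intros)
  \<comment> \<open>For \<open>k > 0\<close> the expression inverted is
    \<open>precision p \<sigma> k / real k\<close>; its limit 1/2 is nonzero, so inversion is
    continuous there.\<close>
  then have "(\<lambda>k. inverse ((precision p \<sigma> k - real k / 2) / real k + 1 / 2)) \<longlonglongrightarrow> inverse (0 + 1 / 2)"
    by (rule tendsto_inverse) simp
  moreover have "\<forall>\<^sub>F k in sequentially.
      inverse ((precision p \<sigma> k - real k / 2) / real k + 1 / 2) = real k * covariance p \<sigma> k"
    using eventually_gt_at_top[of 0]
  proof eventually_elim
    case (elim k)
    then have "(precision p \<sigma> k - real k / 2) / real k + 1 / 2 = precision p \<sigma> k / real k"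
      by (simp add: field_simps)
    then show ?case
      by (simp add: covariance_def)
  qed
  ultimately show ?thesis
    using tendsto_cong by fastforce
qed

theorem theorem3:
  fixes M :: "'w measure" and \<sigma> :: real and x\<^sub>0 :: "'w \<Rightarrow> real" and v \<epsilon> :: "nat \<Rightarrow> 'w \<Rightarrow> real"
  assumes "\<sigma> > 0"
    and "localization_game M \<sigma> x\<^sub>0 v \<epsilon>"
  shows "(\<forall>k\<ge>1. mean_square_error M Us \<sigma> x\<^sub>0 v \<epsilon> k = covariance Us \<sigma> k)
       \<and> (\<lambda>k. real k * covariance Us \<sigma> k) \<longlonglongrightarrow> 2
       \<and> (\<forall>k\<ge>1. mean_square_error M Adversary \<sigma> x\<^sub>0 v \<epsilon> k = covariance Adversary \<sigma> k)
       \<and> (\<lambda>k. real k * covariance Adversary \<sigma> k) \<longlonglongrightarrow> 2"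
  using mean_square_error_eq_covariance[OF assms] covariance_asymptotics[OF assms(1)] by blast

end
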